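(* Let $P,Q\in\mathbb{Z}$ with $PQ\neq 0$, let $p$ be a prime dividing both $P$ and $Q$, and write $P=p^aP'$, $Q=p^bQ'$ with $a,b\geq1$ and $p\nmid P'Q'$. Suppose $b<2a$ and let $r\geq 1$ be an integer, and let $S=\mathcal{L}(P,Q,p^{-r})$. Then \[ S=2T\cup S_{2\lceil r/b\rceil}(1;2), \] where $T$ is the numerical semigroup \begin{enumerate} \item $S_{\lceil (r-a+b)/b\rceil_+}\cup\langle p\rangle$ if $2\leq p\leq 3$, $2a=b+1$, and $P'^2-Q'=0$; \item $S_{\lceil (r-a+b)/b\rceil_+}\cup\{n\in\langle p\rangle : \nu_p(n)\geq r-a+b-\nu_p(P'^2-Q')-bn\}$ if $2\leq p\leq 3$, $2a=b+1$, and $P'^2-Q'\neq 0$; \item $S_{\lceil (r-a+b)/b\rceil_+}\cup\{n\in\langle p\rangle : \nu_p(n)\geq r-a+b-bn\}$ otherwise. \end{enumerate} The Frobenius number of $S$ is $2\lceil r/b\rceil$ or $2\lceil r/b\rceil-1$. Moreover, $\mathfrak{s}(S)=\varnothing$ or $\gcd\mathfrak{s}(S)\geq 2$.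
   Context: $\mathbb{N}=\{0,1,2,\ldots\}$. For $P,Q\in\mathbb{Z}$, the Lucas sequence $U_n=U_n(P,Q)$ is defined by $U_0=0$, $U_1=1$, $U_{n+2}=PU_{n+1}-QU_n$. For $R\in\mathbb{Q}$, $\mathcal{L}(P,Q,R)=\{n\in\mathbb{N} : U_nR\in\mathbb{Z}\}$. $\nu_p$ is the $p$-adic valuation ($\nu_p(0)=\infty$). $\langle p\rangle=p\mathbb{N}$; $2T=\{2t: t\in T\}$. $\lceil x\rceil_+=\max\{\lceil x\rceil,0\}$. For $m\geq 0$, $S_m=\{0\}\cup\{n\in\mathbb{N}: n\geq m\}$, and $S_m(c;h)=\{x\in S_m : x\equiv c \pmod h\}$. A numerical semigroup is an additive submonoid of $\mathbb{N}$ with finite complement; its Frobenius number $g(S)$ is the largest integer not in $S$, and $\mathfrak{s}(S)=\{n\in S\setminus\{0\}: n<g(S)\}$. *)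

theory Defs
  imports
    Complex_Main
    "HOL-Computational_Algebra.Primes"
    "HOL-Library.Extended_Real"
begin

fun lucas_U :: "int \<Rightarrow> int \<Rightarrow> nat \<Rightarrow> int" where
  "lucas_U P Q 0 = 0"
| "lucas_U P Q (Suc 0) = 1"
| "lucas_U P Q (Suc (Suc n)) = P * lucas_U P Q (Suc n) - Q * lucas_U P Q n"

definition lucas_int_set :: "int \<Rightarrow> int \<Rightarrow> rat \<Rightarrow> nat set" where
  "lucas_int_set P Q R = {n. of_int (lucas_U P Q n) * R \<in> \<int>}"

text \<open>Unlike the library's \<open>multiplicity\<close>, this valuation is infinite at \<open>0\<close>.\<close>
definition val :: "nat \<Rightarrow> int \<Rightarrow> ereal" where
  "val p x = (if x = 0 then \<infinity> else ereal (real (multiplicity (int p) x)))"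

definition multiples :: "nat \<Rightarrow> nat set" where
  "multiples p = range (\<lambda>k. p * k)"

definition ceil_plus :: "real \<Rightarrow> int" where
  "ceil_plus x = max \<lceil>x\<rceil> 0"

text \<open>\<open>S_from m\<close> is only meant for \<open>m \<ge> 0\<close>; the bound has type \<open>int\<close> so that
  ceilings can be used without conversion.\<close>
definition S_from :: "int \<Rightarrow> nat set" where
  "S_from m = {0} \<union> {n. int n \<ge> m}"

definition S_from_mod :: "int \<Rightarrow> nat \<Rightarrow> nat \<Rightarrow> nat set" where
  "S_from_mod m c h = {x \<in> S_from m. x mod h = c mod h}"

definition numerical_semigroup :: "nat set \<Rightarrow> bool" where
  "numerical_semigroup S \<longleftrightarrow>
     0 \<in> S \<and> (\<forall>x\<in>S. \<forall>y\<in>S. x + y \<in> S) \<and> finite (- S)"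

text \<open>The maximum is taken over all integers, so the value for \<open>UNIV\<close> is \<open>-1\<close>.\<close>
definition frobenius_number :: "nat set \<Rightarrow> int" where
  "frobenius_number S = (GREATEST z. z \<notin> int ` S)"

definition small_elements :: "nat set \<Rightarrow> nat set" where
  "small_elements S = {n \<in> S - {0}. int n < frobenius_number S}"

end

theory Submission
  imports Defs
begin

text \<open>
  Since \<open>U\<^sub>2\<^sub>k(P,Q) = P U\<^sub>k(P\<^sup>2 - 2Q, Q\<^sup>2)\<close> and \<open>p\<^sup>b\<close> can be scaled out of the new parameters,
  the even-indexed terms reduce to \<open>u\<^sub>k = U\<^sub>k(D + 2s, s\<^sup>2)\<close> with \<open>s = - Q'\<close> and
  \<open>D = p\<^bsup>2a-b\<^esup> P'\<^sup>2\<close> divisible by \<open>p\<close>. Expanding around the degenerate case \<open>D = 0\<close> gives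
  \<open>s u\<^sub>k \<equiv> k s\<^sup>k\<close> modulo \<open>D\<close>, so \<open>p\<close> divides \<open>u\<^sub>k\<close> iff it divides \<open>k\<close>, and the
  odd-indexed terms have valuation exactly \<open>bk\<close>. A binomial expansion of \<open>u\<^sub>m\<^sub>n\<close> in powers of \<open>u\<^sub>n\<close>
  lifts the exponent: \<open>\<nu>(u\<^sub>k) = \<nu>(u\<^sub>p) + \<nu>(k) - 1\<close> for \<open>p\<close> dividing \<open>k\<close>.
  Finally \<open>\<nu>(u\<^sub>p) = 1\<close>, except that \<open>u\<^sub>2\<close> and \<open>u\<^sub>3\<close> contain the factor \<open>P'\<^sup>2 - Q'\<close> when \<open>2a = b + 1\<close>.
\<close>

section \<open>Addition and multiplication of indices\<close>

text \<open>For the companion matrix \<open>M\<close> one has \<open>M^n = U_n M + X\<close>,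
  applied here to the sequence at index \<open>i\<close>. The coefficient \<open>X\<close> is
  \<open>- Q U_(n-1)\<close> for positive \<open>n\<close>; writing it without a predecessor also
  covers \<open>n = 0\<close>.\<close>

lemma lucas_U_add:
  "lucas_U P Q (n + i) = lucas_U P Q n * lucas_U P Q (Suc i)
     + (lucas_U P Q (Suc n) - P * lucas_U P Q n) * lucas_U P Q i"
proof (induction i rule: induct_nat_012)
  case (ge2 i)
  have "lucas_U P Q (n + Suc (Suc i)) = P * lucas_U P Q (n + Suc i) - Q * lucas_U P Q (n + i)"
    by simp
  thus ?case
    unfolding ge2 by (simp add: algebra_simps)
qed auto

text \<open>With \<open>M\<close> the companion matrix, \<open>M\<^sup>n = u\<^sub>n M + X\<close>; this is the binomial expansion of its \<open>m\<close>-th power.\<close>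

lemma lucas_U_mult_add:
  fixes P Q :: int and n :: nat
  defines "X \<equiv> lucas_U P Q (Suc n) - P * lucas_U P Q n"
  shows "lucas_U P Q (n * m + i) =
    (\<Sum>j\<le>m. int (m choose j) * lucas_U P Q n ^ j * X ^ (m - j) * lucas_U P Q (i + j))"
proof (induction m arbitrary: i)
  case 0
  show ?case by simp
next
  case (Suc m)
  let ?u = "lucas_U P Q n"
  let ?f = "\<lambda>j. ?u ^ j * X ^ (Suc m - j) * lucas_U P Q (i + j)"
  have "lucas_U P Q (n * Suc m + i) = lucas_U P Q (n + (n * m + i))"
    by (simp add: algebra_simps)
  also have "\<dots> = ?u * lucas_U P Q (n * m + Suc i) + X * lucas_U P Q (n * m + i)"
    by (subst lucas_U_add) (simp add: X_def)
  also have "?u * lucas_U P Q (n * m + Suc i) = (\<Sum>j\<le>m. int (m choose j) * ?f (Suc j))"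
    unfolding Suc by (simp add: sum_distrib_left mult_ac)
  also have "X * lucas_U P Q (n * m + i) = (\<Sum>j\<le>m. int (m choose j) * ?f j)"
    unfolding Suc sum_distrib_left by (intro sum.cong) (auto simp: Suc_diff_le mult_ac)
  also have "\<dots> = (\<Sum>j\<le>Suc m. int (m choose j) * ?f j)"
    by simp
  also have "\<dots> = ?f 0 + (\<Sum>j\<le>m. int (m choose Suc j) * ?f (Suc j))"
    by (subst sum.atMost_Suc_shift) simp
  also have "(\<Sum>j\<le>m. int (m choose j) * ?f (Suc j)) +
      (?f 0 + (\<Sum>j\<le>m. int (m choose Suc j) * ?f (Suc j)))
      = ?f 0 + (\<Sum>j\<le>m. int (Suc m choose Suc j) * ?f (Suc j))"
    by (simp add: sum.distrib distrib_right)
  also have "\<dots> = (\<Sum>j\<le>Suc m. int (Suc m choose j) * ?f j)"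
    by (subst sum.atMost_Suc_shift) simp
  finally show ?case
    by (simp add: mult_ac)
qed

text \<open>The term for \<open>j = 0\<close> of the binomial expansion vanishes since
  \<open>U_0 = 0\<close>, so one factor \<open>u\<close> comes out. The linear term is split off
  because it decides the valuation of the cofactor; all others still contain
  \<open>u\<close>.\<close>

lemma lucas_U_mult_factor:
  fixes P Q :: int and n m :: nat
  defines "u \<equiv> lucas_U P Q n" and "X \<equiv> lucas_U P Q (Suc n) - P * lucas_U P Q n"
  shows "lucas_U P Q (n * Suc m) = u * (int (Suc m) * X ^ m +
    (\<Sum>j\<in>{1..m}. int (Suc m choose Suc j) * u ^ j * X ^ (m - j) * lucas_U P Q (Suc j)))"
proof -
  let ?g = "\<lambda>j. int (Suc m choose Suc j) * u ^ j * X ^ (m - j) * lucas_U P Q (Suc j)"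
  have "lucas_U P Q (n * Suc m) = (\<Sum>j\<le>Suc m. int (Suc m choose j) * u ^ j * X ^ (Suc m - j) * lucas_U P Q j)"
    using lucas_U_mult_add[of P Q n "Suc m" 0] by (simp only: u_def X_def add_0 add_0_right)
  also have "\<dots> = (\<Sum>j\<le>m. u * ?g j)"
    by (subst sum.atMost_Suc_shift) (simp del: binomial_Suc_Suc add: mult_ac)
  also have "\<dots> = u * (\<Sum>j\<le>m. ?g j)"
    by (simp only: sum_distrib_left)
  also have "{..m} = insert 0 {1..m}"
    by auto
  also have "(\<Sum>j\<in>insert 0 {1..m}. ?g j) = int (Suc m) * X ^ m + (\<Sum>j\<in>{1..m}. ?g j)"
    by (subst sum.insert) auto
  finally show ?thesis .
qed

section \<open>Separating even and odd indices, and scaling the parameters\<close>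

text \<open>If \<alpha> and \<beta> are the characteristic roots, every second term obeys the
  recurrence with roots \<alpha>^2 and \<beta>^2, whose sum is \<open>P^2 - 2Q\<close> and whose
  product is \<open>Q^2\<close>.\<close>

lemma lucas_U_step4:
  "lucas_U P Q (n + 4) = (P\<^sup>2 - 2 * Q) * lucas_U P Q (n + 2) - Q\<^sup>2 * lucas_U P Q n"
  by (simp add: algebra_simps power2_eq_square numeral_eq_Suc)

lemma lucas_U_even_index:
  "lucas_U P Q (2 * k) = P * lucas_U (P\<^sup>2 - 2 * Q) (Q\<^sup>2) k"
proof (induction k rule: induct_nat_012)
  case (ge2 k)
  have "lucas_U P Q (2 * Suc (Suc k)) =
      (P\<^sup>2 - 2 * Q) * lucas_U P Q (2 * Suc k) - Q\<^sup>2 * lucas_U P Q (2 * k)"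
    using lucas_U_step4[of P Q "2 * k"] by (simp add: numeral_eq_Suc)
  thus ?case
    unfolding ge2 by (simp add: algebra_simps)
qed (auto simp: numeral_eq_Suc)

lemma lucas_U_odd_index:
  "lucas_U P Q (2 * k + 1) =
     lucas_U (P\<^sup>2 - 2 * Q) (Q\<^sup>2) (Suc k) + Q * lucas_U (P\<^sup>2 - 2 * Q) (Q\<^sup>2) k"
proof (induction k rule: induct_nat_012)
  case (ge2 k)
  have "lucas_U P Q (2 * Suc (Suc k) + 1) =
      (P\<^sup>2 - 2 * Q) * lucas_U P Q (2 * Suc k + 1) - Q\<^sup>2 * lucas_U P Q (2 * k + 1)"
    using lucas_U_step4[of P Q "2 * k + 1"] by (simp add: numeral_eq_Suc)
  thus ?case
    unfolding ge2 by (simp add: algebra_simps)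
qed (auto simp: numeral_eq_Suc power2_eq_square)

text \<open>Scaling both characteristic roots by \<open>d\<close> scales the \<open>k\<close>-th
  term by \<open>d^(k-1)\<close>; the extra \<open>d\<close> on the left avoids that exponent at
  \<open>k = 0\<close>.\<close>

lemma lucas_U_scale:
  "d * lucas_U (d * A) (d\<^sup>2 * B) k = d ^ k * lucas_U A B k"
proof (induction k rule: induct_nat_012)
  case (ge2 k)
  have "d * lucas_U (d * A) (d\<^sup>2 * B) (Suc (Suc k)) =
      d * A * (d * lucas_U (d * A) (d\<^sup>2 * B) (Suc k)) - d\<^sup>2 * B * (d * lucas_U (d * A) (d\<^sup>2 * B) k)"
    by (simp add: algebra_simps)
  also have "\<dots> = d ^ Suc (Suc k) * lucas_U A B (Suc (Suc k))"
    unfolding ge2 by (simp add: algebra_simps power2_eq_square)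
  finally show ?case .
qed auto

section \<open>Expansion in powers of \<open>D\<close>\<close>

text \<open>At \<open>D = 0\<close> the characteristic polynomial is \<open>(x - s)^2\<close>, which
  gives the terms \<open>k s^(k-1)\<close>. The factor \<open>s\<close> removes the exponent
  \<open>k - 1\<close>.\<close>

lemma lucas_U_cong_disc:
  "D dvd s * lucas_U (D + 2 * s) (s\<^sup>2) k - int k * s ^ k"
proof (induction k rule: induct_nat_012)
  case (ge2 k)
  then obtain x y where
    x: "s * lucas_U (D + 2 * s) (s\<^sup>2) k = int k * s ^ k + D * x" and
    y: "s * lucas_U (D + 2 * s) (s\<^sup>2) (Suc k) = int (Suc k) * s ^ Suc k + D * y"
    unfolding dvd_def by (metis add_diff_cancel_left' diff_add_cancel add.commute)
  have "s * lucas_U (D + 2 * s) (s\<^sup>2) (Suc (Suc k)) =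
      (D + 2 * s) * (s * lucas_U (D + 2 * s) (s\<^sup>2) (Suc k)) - s\<^sup>2 * (s * lucas_U (D + 2 * s) (s\<^sup>2) k)"
    by (simp add: algebra_simps)
  also have "\<dots> - int (Suc (Suc k)) * s ^ Suc (Suc k)
      = D * (int (Suc k) * s ^ Suc k + (D + 2 * s) * y - s\<^sup>2 * x)"
    unfolding x y by (simp add: algebra_simps power2_eq_square)
  finally show ?case by simp
qed auto

text \<open>The next coefficient of the expansion is \<open>((k+1) choose 3) s^(k-2)\<close>; the
  factor \<open>6 s^2\<close> clears its denominator and the negative exponents. It serves primes
  \<open>p \<ge> 5\<close>, for which 6 is invertible.\<close>

lemma lucas_U_cong_disc_square:
  "D\<^sup>2 dvd 6 * s\<^sup>2 * lucas_U (D + 2 * s) (s\<^sup>2) k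
     - (6 * int k * s ^ Suc k + (int k ^ 3 - int k) * D * s ^ k)"
proof (induction k rule: induct_nat_012)
  case (ge2 k)
  let ?u = "lucas_U (D + 2 * s) (s\<^sup>2)"
  from ge2 obtain x y where
    x: "6 * s\<^sup>2 * ?u k = 6 * int k * s ^ Suc k + (int k ^ 3 - int k) * D * s ^ k + D\<^sup>2 * x" and
    y: "6 * s\<^sup>2 * ?u (Suc k) = 6 * int (Suc k) * s ^ Suc (Suc k)
      + (int (Suc k) ^ 3 - int (Suc k)) * D * s ^ Suc k + D\<^sup>2 * y"
    unfolding dvd_def by (metis add_diff_cancel_left' diff_add_cancel add.commute)
  have "6 * s\<^sup>2 * ?u (Suc (Suc k)) = (D + 2 * s) * (6 * s\<^sup>2 * ?u (Suc k)) - s\<^sup>2 * (6 * s\<^sup>2 * ?u k)"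
    by (simp add: algebra_simps)
  also have "\<dots> - (6 * int (Suc (Suc k)) * s ^ Suc (Suc (Suc k))
        + (int (Suc (Suc k)) ^ 3 - int (Suc (Suc k))) * D * s ^ Suc (Suc k))
      = D\<^sup>2 * ((int (Suc k) ^ 3 - int (Suc k)) * s ^ Suc k + (D + 2 * s) * y - s\<^sup>2 * x)"
    unfolding x y by (simp add: algebra_simps power2_eq_square power3_eq_cube)
  finally show ?case by simp
qed (auto simp: power2_eq_square)

section \<open>Valuations when \<open>p\<close> divides \<open>D\<close> but not
  \<open>s\<close>\<close>

context
  fixes p :: nat and D s :: int and u :: "nat \<Rightarrow> int"
  assumes p: "prime p" and D: "int p dvd D" and s: "\<not> int p dvd s"
  defines "u \<equiv> lucas_U (D + 2 * s) (s\<^sup>2)"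
begin

lemma prime_int_p: "prime (int p)"
  using p by simp

lemma dvd_lucas_U_iff: "int p dvd u k \<longleftrightarrow> p dvd k"
proof -
  have "int p dvd s * u k - int k * s ^ k"
    using lucas_U_cong_disc[of D s k] D unfolding u_def by (rule dvd_trans[rotated])
  hence "int p dvd s * u k \<longleftrightarrow> int p dvd int k * s ^ k"
    by (metis diff_add_cancel dvd_add_right_iff)
  thus ?thesis
    using s prime_int_p by (auto simp: prime_dvd_mult_iff dest: prime_dvd_power[OF prime_int_p])
qed

text \<open>This is the coefficient \<open>X\<close> of the binomial expansion. If \<open>p\<close>
  divided it, then \<open>p\<close> would divide \<open>u (Suc n)\<close> as well as
  \<open>u n\<close>, hence both \<open>n\<close> and \<open>Suc n\<close>.\<close>

lemma lucas_U_shift_not_dvd: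
  assumes "p dvd n"
  shows "\<not> int p dvd u (Suc n) - (D + 2 * s) * u n"
proof
  assume *: "int p dvd u (Suc n) - (D + 2 * s) * u n"
  have "int p dvd u n"
    using assms by (simp add: dvd_lucas_U_iff)
  with * have "int p dvd u (Suc n)"
    by (metis dvd_mult diff_add_cancel dvd_add)
  hence "p dvd Suc n"
    by (simp add: dvd_lucas_U_iff)
  with assms p show False
    by (metis dvd_add_right_iff Suc_eq_plus1 not_prime_unit)
qed

text \<open>In the cofactor the linear term \<open>m X^(m-1)\<close> is prime to \<open>p\<close>,
  while all other terms contain \<open>u n\<close>. Stating this with a cofactor keeps it meaningful
  when \<open>u n = 0\<close>.\<close>

lemma lucas_U_mult_coprime:
  assumes "p dvd n" "\<not> p dvd m"
  obtains t where "u (n * m) = u n * t" "\<not> int p dvd t"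
proof -
  define X where "X = u (Suc n) - (D + 2 * s) * u n"
  obtain m' where m': "m = Suc m'"
    using assms by (cases m) auto
  let ?r = "\<Sum>j\<in>{1..m'}. int (Suc m' choose Suc j) * u n ^ j * X ^ (m' - j) * u (Suc j)"
  have "int p dvd u n"
    using assms by (simp add: dvd_lucas_U_iff)
  hence "int p dvd u n ^ j" if "j \<ge> 1" for j
    using that by (auto intro: dvd_trans dvd_power)
  hence "int p dvd ?r"
    by (intro dvd_sum dvd_mult2 dvd_mult) auto
  moreover have "\<not> int p dvd X"
    using lucas_U_shift_not_dvd assms unfolding X_def by blast
  hence "\<not> int p dvd int (Suc m') * X ^ m'"
    using prime_int_p assms m' by (auto simp: prime_dvd_mult_iff simp del: of_nat_Suc dest: prime_dvd_power[OF prime_int_p])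
  ultimately have "\<not> int p dvd int (Suc m') * X ^ m' + ?r"
    by (metis dvd_add_left_iff)
  moreover have "u (n * m) = u n * (int (Suc m') * X ^ m' + ?r)"
    unfolding m' u_def X_def by (rule lucas_U_mult_factor)
  ultimately show ?thesis
    using that by blast
qed

text \<open>The linear term \<open>p X^(p-1)\<close> of the cofactor contains \<open>p\<close>
  exactly once, and the remaining terms are divisible by \<open>p^2\<close>.\<close>

lemma lucas_U_mult_prime:
  assumes "p dvd n"
  obtains t where "u (n * p) = u n * (int p * t)" "\<not> int p dvd t"
proof -
  define X where "X = u (Suc n) - (D + 2 * s) * u n"
  obtain m' where m': "p = Suc m'"
    using prime_gt_0_nat[OF p] by (cases p) auto
  let ?r = "\<Sum>j\<in>{1..m'}. int (Suc m' choose Suc j) * u n ^ j * X ^ (m' - j) * u (Suc j)"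
  have un: "int p dvd u n"
    using assms by (simp add: dvd_lucas_U_iff)
  have "int p * int p dvd ?r"
  proof (rule dvd_sum)
    fix j assume j: "j \<in> {1..m'}"
    have 1: "int p dvd u n ^ j"
      using un j by (auto intro: dvd_trans dvd_power)
    have 2: "int p dvd int (Suc m' choose Suc j) * u (Suc j)"
    \<comment> \<open>One factor \<open>p\<close> comes from the power of \<open>u n\<close>. The
      second comes from the binomial coefficient, except at the top index, where that coefficient is
      1 and \<open>u p\<close> supplies it.\<close>
    proof (cases "Suc j = p")
      case True
      have "int p dvd u (Suc j)"
        by (subst dvd_lucas_U_iff) (simp add: True)
      thus ?thesis by simp
    next
      case False
      with j m' have "p dvd (p choose Suc j)"
        using p by (intro dvd_choose_prime) auto
      thus ?thesis
        unfolding m' by (intro dvd_mult2) (simp only: of_nat_dvd_iff)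
    qed
    from mult_dvd_mono[OF 1 2] have "int p * int p dvd
        u n ^ j * (int (Suc m' choose Suc j) * u (Suc j)) * X ^ (m' - j)"
      by (rule dvd_mult2)
    thus "int p * int p dvd int (Suc m' choose Suc j) * u n ^ j * X ^ (m' - j) * u (Suc j)"
      by (simp only: mult_ac)
  qed
  then obtain z where z: "?r = int p * (int p * z)"
    by (metis dvd_def mult.assoc)
  have "\<not> int p dvd X"
    using lucas_U_shift_not_dvd assms unfolding X_def by blast
  hence "\<not> int p dvd X ^ m'"
    using prime_int_p by (auto dest: prime_dvd_power[OF prime_int_p])
  hence "\<not> int p dvd X ^ m' + int p * z"
    by (metis dvd_add_left_iff dvd_triv_left)
  moreover have "u (n * p) = u n * (int (Suc m') * X ^ m' + ?r)"
    unfolding m' u_def X_def by (rule lucas_U_mult_factor)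
  hence "u (n * p) = u n * (int p * (X ^ m' + int p * z))"
    unfolding z by (simp add: m' algebra_simps)
  ultimately show ?thesis
    using that by blast
qed

text \<open>Write \<open>k = p^i * m\<close> with \<open>m\<close> prime to \<open>p\<close>: each
  of the \<open>i - 1\<close> steps from \<open>p\<close> to \<open>p^i\<close> adds one factor
  \<open>p\<close>, and \<open>m\<close> adds none. The \<open>int p\<close> on the left replaces
  the exponent \<open>i - 1\<close> by \<open>i\<close>.\<close>

lemma lucas_U_multiple_of_prime:
  assumes "p dvd k" "k \<noteq> 0"
  obtains t where "int p * u k = u p * t" "t \<noteq> 0" "multiplicity (int p) t = multiplicity p k"
proof -
  \<comment> \<open>The induction starts at index \<open>p\<close> rather than 1, since
    \<open>lucas_U_mult_prime\<close> requires an index divisible by \<open>p\<close>.\<close>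
  have *: "\<exists>t. u (p * p ^ i) = u p * (int p ^ i * t) \<and> \<not> int p dvd t" for i
  proof (induction i)
    case 0
    show ?case using prime_int_p by (intro exI[of _ 1]) (auto dest: not_prime_unit)
  next
    case (Suc i)
    then obtain t where t: "u (p * p ^ i) = u p * (int p ^ i * t)" "\<not> int p dvd t"
      by blast
    obtain t' where t': "u (p * p ^ i * p) = u (p * p ^ i) * (int p * t')" "\<not> int p dvd t'"
      by (rule lucas_U_mult_prime[of "p * p ^ i"]) auto
    show ?case
      using t t' prime_int_p by (intro exI[of _ "t * t'"]) (auto simp: mult_ac prime_dvd_mult_iff)
  qed
  define i where "i = multiplicity p k"
  have "i > 0"
    using assms p unfolding i_def by (simp add: prime_multiplicity_gt_zero_iff)
  obtain m where m: "k = p ^ i * m" "\<not> p dvd m"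
    using assms p multiplicity_decompose'[of k p] unfolding i_def
    by (metis not_prime_unit)
  have pi: "p ^ i = p * p ^ (i - 1)"
    using \<open>i > 0\<close> by (cases i) auto
  from *[of "i - 1"] obtain t where
    t: "u (p ^ i) = u p * (int p ^ (i - 1) * t)" "\<not> int p dvd t"
    unfolding pi by blast
  obtain t' where t': "u k = u (p ^ i) * t'" "\<not> int p dvd t'"
    using lucas_U_mult_coprime[of "p ^ i" m] m pi by auto
  have "int p * u k = u p * ((int p * int p ^ (i - 1)) * (t * t'))"
    unfolding t t' by (simp add: mult_ac)
  also have "int p * int p ^ (i - 1) = int p ^ i"
    using \<open>i > 0\<close> by (cases i) auto
  finally have 1: "int p * u k = u p * (int p ^ i * (t * t'))" .
  have tt: "\<not> int p dvd t * t'"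
    using t t' prime_int_p by (auto simp: prime_dvd_mult_iff)
  hence 2: "int p ^ i * (t * t') \<noteq> 0"
    using p by auto
  have "multiplicity (int p) (int p ^ i * (t * t')) = i"
    by (rule multiplicity_eqI) (use tt p in \<open>auto simp: mult_ac\<close>)
  thus ?thesis
    using that[OF 1 2] unfolding i_def by simp
qed

text \<open>Modulo \<open>p^2\<close> the second-order expansion reduces to
  \<open>6 s^2 u_p = 6 p s^(p+1)\<close>: in the \<open>D\<close>-term one factor \<open>p\<close>
  comes from \<open>p^3 - p\<close>, the other from \<open>D\<close>.\<close>

lemma lucas_U_prime_ge_5:
  assumes "p \<ge> 5"
  obtains t where "u p = int p * t" "\<not> int p dvd t"
proof -
  have "int p dvd u p"
    by (simp add: dvd_lucas_U_iff)
  then obtain t where t: "u p = int p * t"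
    by (elim dvdE)
  have "\<not> int p dvd t"
  proof
    assume "int p dvd t"
    hence "int p ^ 2 dvd 6 * s\<^sup>2 * u p"
      unfolding t by (auto simp: power2_eq_square)
    moreover have "int p ^ 2 dvd D\<^sup>2"
      using D by (rule dvd_power_same)
    hence "int p ^ 2 dvd 6 * s\<^sup>2 * u p
     - (6 * int p * s ^ Suc p + (int p ^ 3 - int p) * D * s ^ p)"
      using lucas_U_cong_disc_square[of D s p] unfolding u_def by (rule dvd_trans)
    ultimately have "int p ^ 2 dvd 6 * int p * s ^ Suc p + (int p ^ 3 - int p) * D * s ^ p"
      by (metis dvd_diff diff_diff_eq2 add_diff_cancel_left')
    moreover have "int p ^ 2 dvd (int p ^ 3 - int p) * D * s ^ p"
      unfolding power2_eq_square by (intro dvd_mult2 mult_dvd_mono D) (simp add: power3_eq_cube)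
    ultimately have "int p * int p dvd int p * (6 * s ^ Suc p)"
      unfolding power2_eq_square by (simp add: dvd_add_left_iff mult_ac)
    hence "int p dvd 6 * s ^ Suc p"
      using p by (simp add: prime_gt_0_nat)
    hence "int p dvd 6"
      using s prime_int_p by (auto simp: prime_dvd_mult_iff dest: prime_dvd_power[OF prime_int_p])
    hence "p dvd 2 * 3"
      by presburger
    hence "p dvd 2 \<or> p dvd 3"
      using p by (simp only: prime_dvd_mult_iff)
    thus False
      using assms by (auto dest!: dvd_imp_le)
  qed
  with t that show ?thesis by blast
qed

text \<open>For \<open>p = 2, 3\<close> the value \<open>u p\<close> is computed outright.
  \<open>E\<close> is kept as an explicit factor because it may have any valuation, or be 0.\<close>

lemma lucas_U_prime_index:
  fixes x :: int and c :: nat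
  assumes Deq: "D = int p ^ c * x\<^sup>2" and "c \<ge> 1"
  defines "E \<equiv> if p \<le> 3 \<and> c = 1 then x\<^sup>2 + s else 1"
  obtains t where "u p = int p * (E * t)" "\<not> int p dvd t"
proof -
  have D': "D = int p * (int p ^ (c - 1) * x\<^sup>2)"
    using \<open>c \<ge> 1\<close> unfolding Deq by (cases c) auto
  \<comment> \<open>Chosen so that \<open>D + p * s = p * y\<close>: this is \<open>u 2\<close> for
    \<open>p = 2\<close>, and for \<open>p = 3\<close> a factor of
    \<open>u 3 = (D + s) (D + 3 s)\<close>. For \<open>c > 1\<close> it is congruent to
    \<open>s\<close> modulo \<open>p\<close>; for \<open>c = 1\<close> it is
    \<open>E\<close>.\<close>
  define y where "y = int p ^ (c - 1) * x\<^sup>2 + s"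
  have y: "y = E" if "p \<le> 3" "c = 1"
    using that by (simp add: y_def E_def)
  have y': "\<not> int p dvd y" if "c \<noteq> 1"
  proof -
    have "c - 1 > 0" using that \<open>c \<ge> 1\<close> by simp
    hence "int p dvd int p ^ (c - 1) * x\<^sup>2"
      by (intro dvd_mult2 dvd_power) auto
    thus ?thesis
      using s unfolding y_def by (simp add: dvd_add_right_iff)
  qed
  have "\<exists>z. (y = E * z) \<and> \<not> int p dvd z" if "p \<le> 3"
  proof (cases "c = 1")
    case True
    thus ?thesis using y that prime_int_p by (intro exI[of _ 1]) (auto dest: not_prime_unit)
  next
    case False
    thus ?thesis using y' by (intro exI[of _ y]) (auto simp: E_def)
  qed
  then obtain z where z: "p \<le> 3 \<Longrightarrow> y = E * z" "p \<le> 3 \<Longrightarrow> \<not> int p dvd z"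
    by blast
  have "p \<noteq> 4"
    using p by (auto simp: prime_nat_iff dest!: spec[of _ 2])
  with prime_ge_2_nat[OF p] consider "p = 2" | "p = 3" | "p \<ge> 5"
    by linarith
  thus ?thesis
  proof cases
    case 1
    have "u p = int p * y"
      using D' 1 by (simp add: u_def y_def numeral_eq_Suc)
    thus ?thesis
      using that[of z] z 1 by simp
  next
    case 2
    have "u p = (D + s) * (D + 3 * s)"
      unfolding 2 by (simp add: u_def numeral_eq_Suc algebra_simps power2_eq_square)
    also have "D + 3 * s = int p * y"
      using D' 2 by (simp add: y_def algebra_simps)
    finally have "u p = int p * (E * (z * (D + s)))"
      using z 2 by (simp add: mult_ac)
    moreover have "\<not> int p dvd D + s"
      using D s by (simp add: dvd_add_right_iff)
    hence "\<not> int p dvd z * (D + s)"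
      using z 2 prime_int_p by (auto simp: prime_dvd_mult_iff)
    ultimately show ?thesis
      by (rule that)
  next
    case 3
    thus ?thesis
      using lucas_U_prime_ge_5 that by (auto simp: E_def)
  qed
qed

text \<open>The \<open>int p\<close> in \<open>lucas_U_multiple_of_prime\<close> cancels the one in
  \<open>u p\<close>. Thus \<open>u k\<close> vanishes exactly when \<open>E\<close> does, and
  otherwise its valuation is that of \<open>E\<close> plus that of \<open>k\<close>.\<close>

lemma lucas_U_multiple_index:
  fixes x :: int and c :: nat
  assumes Deq: "D = int p ^ c * x\<^sup>2" and "c \<ge> 1"
  assumes k: "p dvd k" "k \<noteq> 0"
  defines "E \<equiv> if p \<le> 3 \<and> c = 1 then x\<^sup>2 + s else 1"
  obtains t where "u k = E * t" "t \<noteq> 0" "multiplicity (int p) t = multiplicity p k"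
proof -
  obtain t where t: "u p = int p * (E * t)" "\<not> int p dvd t"
    using lucas_U_prime_index[OF Deq \<open>c \<ge> 1\<close>] unfolding E_def by metis
  obtain t' where t': "int p * u k = u p * t'" "t' \<noteq> 0" "multiplicity (int p) t' = multiplicity p k"
    using lucas_U_multiple_of_prime[OF k] by metis
  have "int p * u k = int p * (E * (t * t'))"
    unfolding t' t by (simp add: mult_ac)
  hence "u k = E * (t * t')"
    using p by simp
  moreover have "t * t' \<noteq> 0"
    using t t' by auto
  moreover have "multiplicity (int p) (t * t') = multiplicity p k"
    using t t' prime_int_p
    by (subst prime_elem_multiplicity_mult_distrib) (auto simp: not_dvd_imp_multiplicity_0)
  ultimately show ?thesis
    by (rule that)
qed

text \<open>By the first-order congruence, \<open>s\<close> times this difference is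
  \<open>(k+1) s^(k+1) - k s^(k+1) = s^(k+1)\<close> modulo \<open>p\<close>. With
  \<open>s = - Q'\<close> it is the part prime to \<open>p\<close> of an odd-indexed term.\<close>

lemma lucas_U_consecutive_not_dvd: "\<not> int p dvd u (Suc k) - s * u k"
proof
  assume *: "int p dvd u (Suc k) - s * u k"
  have "int p dvd s * u (Suc k) - int (Suc k) * s ^ Suc k"
    using lucas_U_cong_disc[of D s "Suc k"] D unfolding u_def by (rule dvd_trans[rotated])
  moreover have "int p dvd s * u k - int k * s ^ k"
    using lucas_U_cong_disc[of D s k] D unfolding u_def by (rule dvd_trans[rotated])
  ultimately have "int p dvd s * (u (Suc k) - s * u k)
      - ((s * u (Suc k) - int (Suc k) * s ^ Suc k) - s * (s * u k - int k * s ^ k))"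
    using * by (meson dvd_diff dvd_mult)
  also have "\<dots> = s ^ Suc k"
    by (simp add: algebra_simps)
  finally show False
    using s prime_int_p by (blast dest: prime_dvd_power)
qed

end

section \<open>Divisibility of the original sequence by powers of \<open>p\<close>\<close>

lemma prime_power_dvd_mult_iff:
  assumes "prime p" "y \<noteq> 0"
  shows "int p ^ n dvd int p ^ m * y \<longleftrightarrow> n \<le> m + multiplicity (int p) y"
proof -
  have p: "prime (int p)"
    using assms by simp
  hence "\<not> is_unit (int p)" "int p \<noteq> 0"
    by (auto dest: not_prime_unit)
  moreover from this have "multiplicity (int p) (int p ^ m * y) = m + multiplicity (int p) y"
    using p assms(2)
    by (subst prime_elem_multiplicity_mult_distrib)
       (simp_all add: multiplicity_same_power)
  ultimately show ?thesis
    using assms(2) by (subst power_dvd_iff_le_multiplicity) simp_all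
qed

context
  fixes P Q P' Q' :: int and p a b :: nat
  assumes p: "prime p" and P: "P = int p ^ a * P'" and Q: "Q = int p ^ b * Q'"
    and ndvd: "\<not> int p dvd P'" "\<not> int p dvd Q'" and ab: "b < 2 * a"
begin

text \<open>Scaling by \<open>d = p^b\<close>. The choice \<open>s = - Q'\<close> turns the new
  parameters into \<open>D + 2s\<close> and \<open>s^2\<close>, and \<open>b < 2a\<close> makes
  \<open>D\<close> divisible by \<open>p\<close>.\<close>

lemma lucas_U_scaled:
  "int p ^ b * lucas_U (P\<^sup>2 - 2 * Q) (Q\<^sup>2) k =
     int p ^ (b * k) * lucas_U (int p ^ (2 * a - b) * P'\<^sup>2 + 2 * (- Q')) ((- Q')\<^sup>2) k"
proof -
  have "2 * a = b + (2 * a - b)"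
    using ab by simp
  hence "int p ^ (2 * a) = int p ^ b * int p ^ (2 * a - b)"
    by (metis power_add)
  hence "P\<^sup>2 - 2 * Q = int p ^ b * (int p ^ (2 * a - b) * P'\<^sup>2 + 2 * (- Q'))"
    unfolding P Q by (simp add: power_mult_distrib algebra_simps flip: power_mult)
  moreover have "Q\<^sup>2 = (int p ^ b)\<^sup>2 * (- Q')\<^sup>2"
    unfolding Q by (simp add: power_mult_distrib)
  ultimately show ?thesis
    by (simp only: lucas_U_scale power_mult)
qed

lemma disc_dvd: "int p dvd int p ^ (2 * a - b) * P'\<^sup>2"
  using ab by (intro dvd_mult2 dvd_power) auto

lemma minus_Q'_ndvd: "\<not> int p dvd - Q'"
  using ndvd by simp

text \<open>The factor \<open>p^b\<close> of \<open>Q\<close> brings both summands of the odd-index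
  formula to the same power of \<open>p\<close>, leaving a cofactor prime to
  \<open>p\<close>.\<close>

lemma power_dvd_lucas_U_odd:
  "int p ^ r dvd lucas_U P Q (2 * k + 1) \<longleftrightarrow> r \<le> b * k"
proof -
  let ?u = "lucas_U (int p ^ (2 * a - b) * P'\<^sup>2 + 2 * (- Q')) ((- Q')\<^sup>2)"
  let ?y = "?u (Suc k) - (- Q') * ?u k"
  have y: "\<not> int p dvd ?y"
    by (rule lucas_U_consecutive_not_dvd[OF p disc_dvd minus_Q'_ndvd])
  have "int p ^ b * lucas_U P Q (2 * k + 1) =
      int p ^ (b * Suc k) * ?u (Suc k) + Q * (int p ^ (b * k) * ?u k)"
    unfolding lucas_U_odd_index lucas_U_scaled[symmetric] by (simp add: algebra_simps)
  also have "\<dots> = int p ^ (b + b * k) * ?y"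
    unfolding Q by (simp add: algebra_simps power_add)
  finally have *: "int p ^ b * lucas_U P Q (2 * k + 1) = int p ^ (b + b * k) * ?y" .
  have "int p ^ r dvd lucas_U P Q (2 * k + 1) \<longleftrightarrow>
      int p ^ (b + r) dvd int p ^ b * lucas_U P Q (2 * k + 1)"
    using p by (simp add: power_add prime_gt_0_nat)
  also have "\<dots> \<longleftrightarrow> b + r \<le> b + b * k"
    unfolding * using y p
    by (subst prime_power_dvd_mult_iff) (auto simp: not_dvd_imp_multiplicity_0)
  finally show ?thesis
    by simp
qed

text \<open>The valuation is \<open>a + b(k-1)\<close> plus that of the reduced term;
  \<open>b\<close> is added to both sides to stay within the naturals. \<open>E = 0\<close> is the
  case where the term itself vanishes for \<open>p\<close> dividing \<open>k\<close>.\<close>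

lemma power_dvd_lucas_U_even:
  defines "E \<equiv> if p \<le> 3 \<and> 2 * a = b + 1 then P'\<^sup>2 - Q' else 1"
  assumes "k \<noteq> 0"
  shows "int p ^ r dvd lucas_U P Q (2 * k) \<longleftrightarrow>
    r + b \<le> a + b * k \<or>
    p dvd k \<and> (E = 0 \<or> r + b \<le> a + b * k + multiplicity p k + multiplicity (int p) E)"
proof -
  let ?u = "lucas_U (int p ^ (2 * a - b) * P'\<^sup>2 + 2 * (- Q')) ((- Q')\<^sup>2)"
  have "int p ^ b * lucas_U P Q (2 * k) = P * (int p ^ (b * k) * ?u k)"
    unfolding lucas_U_even_index lucas_U_scaled[symmetric] by (simp add: algebra_simps)
  also have "\<dots> = int p ^ (a + b * k) * (P' * ?u k)"
    unfolding P by (simp add: algebra_simps power_add)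
  finally have *: "int p ^ b * lucas_U P Q (2 * k) = int p ^ (a + b * k) * (P' * ?u k)" .
  have "P' \<noteq> 0" using ndvd by auto
  have mult_P': "multiplicity (int p) (P' * y) = multiplicity (int p) y" if "y \<noteq> 0" for y
    using that p ndvd \<open>P' \<noteq> 0\<close>
    by (subst prime_elem_multiplicity_mult_distrib) (auto simp: not_dvd_imp_multiplicity_0)
  have "int p ^ r dvd lucas_U P Q (2 * k) \<longleftrightarrow>
      int p ^ (r + b) dvd int p ^ b * lucas_U P Q (2 * k)"
    using p by (simp add: power_add prime_gt_0_nat)
  \<comment> \<open>Zero is listed separately because \<open>multiplicity\<close> returns 0 there,
    not infinity.\<close>
  also have "\<dots> \<longleftrightarrow> ?u k = 0 \<or> r + b \<le> a + b * k + multiplicity (int p) (?u k)"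
    unfolding * using p mult_P' \<open>P' \<noteq> 0\<close>
    by (cases "?u k = 0") (simp_all add: prime_power_dvd_mult_iff)
  also have "\<dots> \<longleftrightarrow> r + b \<le> a + b * k \<or>
    p dvd k \<and> (E = 0 \<or> r + b \<le> a + b * k + multiplicity p k + multiplicity (int p) E)"
  proof (cases "p dvd k")
    case False
    hence "\<not> int p dvd ?u k"
      using dvd_lucas_U_iff[OF p disc_dvd minus_Q'_ndvd] by blast
    thus ?thesis
      using False by (auto simp: not_dvd_imp_multiplicity_0)
  next
    case True
    have c: "1 \<le> 2 * a - b" using ab by simp
    have E: "E = (if p \<le> 3 \<and> 2 * a - b = 1 then P'\<^sup>2 + - Q' else 1)"
      using ab by (auto simp: E_def)
    obtain t where t: "?u k = E * t" "t \<noteq> 0" "multiplicity (int p) t = multiplicity p k"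
      using lucas_U_multiple_index[OF p disc_dvd minus_Q'_ndvd refl c True \<open>k \<noteq> 0\<close>]
      unfolding E by metis
    show ?thesis
    proof (cases "E = 0")
      case False
      hence "multiplicity (int p) (?u k) = multiplicity (int p) E + multiplicity p k"
        unfolding t(1) t(3)[symmetric] using p t(2)
        by (intro prime_elem_multiplicity_mult_distrib) auto
      thus ?thesis
        using True False t by auto
    qed (use True t in auto)
  qed
  finally show ?thesis .
qed

end

section \<open>Membership in the set, and the semigroup \<open>T\<close>\<close>

lemma multiplicity_int_int: "multiplicity (int p) (int k) = multiplicity p k"
  unfolding multiplicity_def by (simp flip: of_nat_power)

lemma lucas_int_set_prime_power:
  assumes "prime p"
  shows "n \<in> lucas_int_set P Q (of_nat p powi (- int r)) \<longleftrightarrow> int p ^ r dvd lucas_U P Q n"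
proof -
  have "(of_int (lucas_U P Q n) * of_nat p powi (- int r) :: rat) =
      of_int (lucas_U P Q n) / of_int (int p ^ r)"
    by (simp add: power_int_minus field_simps)
  moreover have "int p ^ r \<noteq> 0"
    using assms by auto
  ultimately show ?thesis
    unfolding lucas_int_set_def mem_Collect_eq by (metis of_int_div_of_int_in_Ints_iff)
qed

text \<open>A common form of the three cases of \<open>T\<close>, with \<open>E0\<close> for
  \<open>E = 0\<close> and \<open>e\<close> for the valuation of \<open>E\<close>;
  \<open>M = r - a + b\<close> may be negative. Sums stay inside because the valuation of
  \<open>x + y\<close> is at least the smaller of the two, while \<open>b * k\<close> grows with
  \<open>k\<close>.\<close>

lemma numerical_semigroup_power_threshold:
  fixes p b e :: nat and M :: int and E0 :: bool
  assumes "prime p" "b \<ge> 1"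
  shows "numerical_semigroup {k. k = 0 \<or> M \<le> int (b * k) \<or>
      p dvd k \<and> (E0 \<or> M \<le> int (b * k + multiplicity p k + e))}" (is "numerical_semigroup ?T")
proof -
  have large: "x + y \<in> ?T" if "M \<le> int (b * x)" for x y
  proof -
    have "b * x \<le> b * (x + y)" by simp
    with that have "M \<le> int (b * (x + y))" by linarith
    thus ?thesis by simp
  qed
  have "x + y \<in> ?T" if x: "x \<in> ?T" and y: "y \<in> ?T" for x y
  proof (cases "x = 0 \<or> y = 0 \<or> M \<le> int (b * x) \<or> M \<le> int (b * y)")
    case True
    thus ?thesis
      using large[of x y] large[of y x] x y by (auto simp: add.commute)
  next
    case False
    with x y have dvd: "p dvd x" "p dvd y"
      and le: "E0 \<or> M \<le> int (b * x + multiplicity p x + e) \<and> M \<le> int (b * y + multiplicity p y + e)"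
      by auto
    have "min (multiplicity p x) (multiplicity p y) \<le> multiplicity p (x + y)"
    proof (rule multiplicity_geI)
      show "p ^ min (multiplicity p x) (multiplicity p y) dvd x + y"
        by (intro dvd_add multiplicity_dvd') auto
    qed (use False assms in \<open>auto dest: not_prime_unit\<close>)
    hence "multiplicity p x \<le> multiplicity p (x + y) \<or> multiplicity p y \<le> multiplicity p (x + y)"
      by linarith
    moreover have "b * (x + y) = b * x + b * y"
      by (simp add: algebra_simps)
    ultimately have "E0 \<or> M \<le> int (b * (x + y) + multiplicity p (x + y) + e)"
      using le by linarith
    with dvd show ?thesis
      by simp
  qed
  moreover have "- ?T \<subseteq> {..nat M}"
  proof
    fix k assume "k \<in> - ?T"
    hence "int (b * k) < M" by auto
    moreover have "k \<le> b * k" using assms by simp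
    ultimately have "int k \<le> M" by linarith
    thus "k \<in> {..nat M}" by simp
  qed
  hence "finite (- ?T)"
    by (rule finite_subset) simp
  ultimately show ?thesis
    unfolding numerical_semigroup_def by auto
qed

section \<open>Semigroups with even part \<open>2T\<close> and all odd numbers from a threshold
  on\<close>

context
  fixes S T :: "nat set" and c :: nat
  assumes T: "numerical_semigroup T" and T_large: "\<And>k. k > c \<Longrightarrow> k \<in> T"
    and even: "\<And>k. 2 * k \<in> S \<longleftrightarrow> k \<in> T" and odd: "\<And>k. 2 * k + 1 \<in> S \<longleftrightarrow> c \<le> k"
    and c: "c \<ge> 1"
begin

lemma parity_set_eq: "S = (\<lambda>t. 2 * t) ` T \<union> S_from_mod (2 * int c) 1 2"
proof (rule set_eqI)
  fix n
  show "n \<in> S \<longleftrightarrow> n \<in> (\<lambda>t. 2 * t) ` T \<union> S_from_mod (2 * int c) 1 2"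
  proof (cases "even n")
    case True
    then obtain k where k: "n = 2 * k" by (rule evenE)
    have "n \<in> (\<lambda>t. 2 * t) ` T \<longleftrightarrow> k \<in> T"
      unfolding k by auto
    moreover have "n \<notin> S_from_mod (2 * int c) 1 2"
      using True by (simp add: S_from_mod_def)
    ultimately show ?thesis
      using even[of k] unfolding k by simp
  next
    case False
    then obtain k where k: "n = 2 * k + 1" by (rule oddE)
    have "n \<notin> (\<lambda>t. 2 * t) ` T"
      using False by auto
    \<comment> \<open>\<open>2 * k + 1 \<ge> 2 * c\<close> amounts to \<open>k \<ge> c\<close>; the
      extra 0 in \<open>S_from\<close> is excluded by parity.\<close>
    moreover have "n \<in> S_from_mod (2 * int c) 1 2 \<longleftrightarrow> c \<le> k"
      unfolding k by (auto simp: S_from_mod_def S_from_def)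
    ultimately show ?thesis
      using odd[of k] unfolding k by simp
  qed
qed

lemma parity_set_large:
  assumes "n > 2 * c"
  shows "n \<in> S"
proof (cases "even n")
  case True
  then obtain k where "n = 2 * k" by (rule evenE)
  thus ?thesis using assms even[of k] T_large[of k] by simp
next
  case False
  then obtain k where "n = 2 * k + 1" by (rule oddE)
  thus ?thesis using assms odd[of k] by simp
qed

text \<open>A sum with an odd summand already exceeds \<open>2 * c\<close>, beyond which everything
  belongs to \<open>S\<close>.\<close>

lemma numerical_semigroup_parity_set: "numerical_semigroup S"
proof -
  have "x + y \<in> S" if x: "x \<in> S" and y: "y \<in> S" for x y
  proof (cases "even x \<and> even y")
    case True
    then obtain i j where ij: "x = 2 * i" "y = 2 * j" by (elim conjE evenE)
    hence "i + j \<in> T"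
      using T x y even unfolding numerical_semigroup_def by auto
    thus ?thesis
      using even[of "i + j"] unfolding ij by simp
  next
    case False
    have "n > 2 * c" if "odd n" "n \<in> S" for n
    proof -
      obtain k where "n = 2 * k + 1" using \<open>odd n\<close> by (rule oddE)
      thus ?thesis
        using that odd[of k] by simp
    qed
    hence "x + y > 2 * c"
      using False x y by fastforce
    thus ?thesis by (rule parity_set_large)
  qed
  moreover have "- S \<subseteq> {..2 * c}"
    using parity_set_large not_le by auto
  hence "finite (- S)"
    by (rule finite_subset) simp
  moreover have "0 \<in> S"
    using T even[of 0] unfolding numerical_semigroup_def by simp
  ultimately show ?thesis
    unfolding numerical_semigroup_def by blast
qed

text \<open>Everything above \<open>2 * c\<close> lies in \<open>S\<close>, and \<open>2 * c\<close>
  does iff \<open>c \<in> T\<close>; the odd number \<open>2 * c - 1\<close> is below the threshold,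
  hence a gap.\<close>

lemma frobenius_number_parity_set:
  "frobenius_number S = (if c \<in> T then 2 * int c - 1 else 2 * int c)"
proof -
  have large: "z \<le> 2 * int c" if "z \<notin> int ` S" for z
  proof (rule ccontr)
    assume "\<not> z \<le> 2 * int c"
    hence "z = int (nat z)" "nat z > 2 * c" by linarith+
    thus False using parity_set_large that by blast
  qed
  show ?thesis
  proof (cases "c \<in> T")
    case True
    have "2 * (c - 1) + 1 \<notin> S"
      using odd[of "c - 1"] c by simp
    moreover have "2 * int c - 1 = int (2 * (c - 1) + 1)"
      using c by (simp add: of_nat_diff)
    ultimately have "2 * int c - 1 \<notin> int ` S"
      by (metis imageE of_nat_eq_iff)
    moreover have "2 * int c \<in> int ` S"
      using True even[of c] by (auto simp: image_iff intro!: bexI[of _ "2 * c"])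
    ultimately show ?thesis
      unfolding frobenius_number_def using True large
      by (subst Greatest_equality) (auto simp: zle_diff1_eq order.strict_iff_order)
  next
    case False
    hence "2 * c \<notin> S"
      using even[of c] by simp
    moreover have "2 * int c = int (2 * c)"
      by simp
    ultimately have "2 * int c \<notin> int ` S"
      by (metis imageE of_nat_eq_iff)
    thus ?thesis
      unfolding frobenius_number_def using False large
      by (intro Greatest_equality) auto
  qed
qed

text \<open>Odd elements are at least \<open>2 * c + 1\<close>, above the Frobenius number, so all
  small elements are even.\<close>

lemma Gcd_small_elements_parity_set:
  "small_elements S = {} \<or> Gcd (small_elements S) \<ge> 2"
proof (cases "small_elements S = {}")
  case False
  then obtain n where n: "n \<in> small_elements S" by blast
  have "2 dvd m" if "m \<in> small_elements S" for m
  proof (rule ccontr)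
    assume "odd m"
    then obtain k where k: "m = 2 * k + 1" by (rule oddE)
    thus False
      using that odd[of k] by (auto simp: small_elements_def frobenius_number_parity_set split: if_splits)
  qed
  hence "2 dvd Gcd (small_elements S)"
    by (rule Gcd_greatest)
  \<comment> \<open>A nonzero element excludes the value 0 of \<open>Gcd\<close>, which 2 would also
    divide.\<close>
  moreover have "n \<noteq> 0"
    using n by (simp add: small_elements_def)
  hence "Gcd (small_elements S) \<noteq> 0"
    using n by (metis Gcd_dvd dvd_0_left)
  ultimately have "Gcd (small_elements S) \<ge> 2"
    by (intro dvd_imp_le) auto
  thus ?thesis ..
qed simp

end

section \<open>The integrality set for \<open>R = p^(-r)\<close>\<close>

theorem theorem5p6:
  fixes P Q P' Q' :: int and p a b r :: nat and S T :: "nat set"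
  assumes "P * Q \<noteq> 0"
    and "prime p" and "int p dvd P" and "int p dvd Q"
    and "a \<ge> 1" and "b \<ge> 1"
    and "P = int p ^ a * P'" and "Q = int p ^ b * Q'"
    and "\<not> int p dvd P' * Q'"
    and "b < 2 * a" and "r \<ge> 1"
    and S_def: "S = lucas_int_set P Q (of_nat p powi (- int r))"
    and T_def: "T =
      (if 2 \<le> p \<and> p \<le> 3 \<and> 2 * a = b + 1 \<and> P'\<^sup>2 - Q' = 0 then
         S_from (ceil_plus ((real r - real a + real b) / real b)) \<union> multiples p
       else if 2 \<le> p \<and> p \<le> 3 \<and> 2 * a = b + 1 \<and> P'\<^sup>2 - Q' \<noteq> 0 then
         S_from (ceil_plus ((real r - real a + real b) / real b)) \<union>
         {n \<in> multiples p. val p (int n) \<ge>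
            ereal (real r - real a + real b) - val p (P'\<^sup>2 - Q') - ereal (real b * real n)}
       else
         S_from (ceil_plus ((real r - real a + real b) / real b)) \<union>
         {n \<in> multiples p. val p (int n) \<ge>
            ereal (real r - real a + real b - real b * real n)})"
  shows "numerical_semigroup T
    \<and> S = (\<lambda>t. 2 * t) ` T \<union> (S_from_mod (2 * \<lceil>real r / real b\<rceil>) 1 2)
    \<and> numerical_semigroup S
    \<and> (frobenius_number S = 2 * \<lceil>real r / real b\<rceil>
        \<or> frobenius_number S = 2 * \<lceil>real r / real b\<rceil> - 1)
    \<and> (small_elements S = {} \<or> Gcd (small_elements S) \<ge> 2)"
proof -
  \<comment> \<open>\<open>E\<close> encodes the three cases at once: 0 in the first, nonzero in the
    second, and 1 (so \<open>e = 0\<close>) in the third.\<close>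
  define E where "E = (if p \<le> 3 \<and> 2 * a = b + 1 then P'\<^sup>2 - Q' else 1)"
  define M where "M = int r - int a + int b"
  define e where "e = multiplicity (int p) E"
  define T' where "T' = {k. k = 0 \<or> M \<le> int (b * k) \<or>
      p dvd k \<and> (E = 0 \<or> M \<le> int (b * k + multiplicity p k + e))}"
  define c where "c = nat \<lceil>real r / real b\<rceil>"
  have p: "prime p" and b: "b \<ge> 1" and r: "r \<ge> 1" and ab: "b < 2 * a" by fact+
  have ndvd: "\<not> int p dvd P'" "\<not> int p dvd Q'"
    using assms by auto
  have c_int: "int c = \<lceil>real r / real b\<rceil>"
  proof -
    have "0 \<le> real r / real b" by simp
    hence "0 \<le> \<lceil>real r / real b\<rceil>" by linarith
    thus ?thesis by (simp add: c_def)
  qed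
  have c_le: "c \<le> k \<longleftrightarrow> r \<le> b * k" for k
  proof -
    have "c \<le> k \<longleftrightarrow> real r / real b \<le> real k"
      using c_int by (metis ceiling_le_iff of_int_of_nat_eq of_nat_le_iff)
    also have "\<dots> \<longleftrightarrow> real r \<le> real (b * k)"
      using b by (simp add: pos_divide_le_eq mult_ac)
    finally show ?thesis
      by (simp only: of_nat_le_iff)
  qed
  have T'_semigroup: "numerical_semigroup T'"
    unfolding T'_def using p b by (rule numerical_semigroup_power_threshold)
  have real_M: "real r - real a + real b = real_of_int M"
    by (simp add: M_def)
  \<comment> \<open>The truncation at 0 in \<open>ceil_plus\<close> has no effect on natural
    \<open>k\<close>.\<close>
  have S_from_M: "k \<in> S_from (ceil_plus ((real r - real a + real b) / real b)) \<longleftrightarrow>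
      k = 0 \<or> M \<le> int (b * k)" for k
  proof -
    have "\<lceil>real_of_int M / real b\<rceil> \<le> int k \<longleftrightarrow> real_of_int M \<le> real_of_int (int (b * k))"
      using b by (simp add: ceiling_le_iff pos_divide_le_eq mult_ac)
    hence "\<lceil>real_of_int M / real b\<rceil> \<le> int k \<longleftrightarrow> M \<le> int (b * k)"
      unfolding of_int_le_iff .
    thus ?thesis
      unfolding real_M S_from_def ceil_plus_def by auto
  qed
  \<comment> \<open>Stated for arbitrary \<open>e\<close>, to be used with the valuation of
    \<open>E\<close> and with 0. At \<open>k = 0\<close> the infinite value of \<open>val\<close>
    makes the inequality true, whence the separate disjunct.\<close>
  have le_val: "ereal (real r - real a + real b - real b * real k) - ereal (real e) \<le> val p (int k)
      \<longleftrightarrow> k = 0 \<or> M \<le> int (b * k + multiplicity p k + e)" for k e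
  proof (cases "k = 0")
    case False
    hence "ereal (real r - real a + real b - real b * real k) - ereal (real e) \<le> val p (int k)
        \<longleftrightarrow> real_of_int M \<le> real_of_int (int (b * k + multiplicity p k + e))"
      by (auto simp: val_def multiplicity_int_int M_def)
    thus ?thesis
      unfolding of_int_le_iff using False by blast
  qed (simp add: val_def)
  have multiples: "k \<in> multiples p \<longleftrightarrow> p dvd k" for k
    by (auto simp: multiples_def)
  have T: "T = T'"
  proof -
    consider (1) "p \<le> 3" "2 * a = b + 1" "P'\<^sup>2 - Q' = 0"
      | (2) "p \<le> 3" "2 * a = b + 1" "P'\<^sup>2 - Q' \<noteq> 0"
      | (3) "\<not> (p \<le> 3 \<and> 2 * a = b + 1)"
      by blast
    thus ?thesis
    proof cases
      case 1
      thus ?thesis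
        using prime_ge_2_nat[OF p] by (auto simp: T_def T'_def E_def S_from_M multiples)
    next
      case 2
      have val_E: "val p (P'\<^sup>2 - Q') = ereal (real e)"
        using 2 by (simp add: val_def e_def E_def)
      have "ereal (real r - real a + real b) - val p (P'\<^sup>2 - Q') - ereal (real b * real k) =
          ereal (real r - real a + real b - real b * real k) - ereal (real e)" for k
        unfolding val_E by simp
      moreover have "E \<noteq> 0"
        using 2 by (simp add: E_def)
      ultimately show ?thesis
        using 2 prime_ge_2_nat[OF p]
        by (auto simp: T_def T'_def S_from_M multiples le_val simp del: ereal_minus)
    next
      case 3
      hence "E = 1" "e = 0"
        by (auto simp: E_def e_def)
      have le_val': "ereal (real r - real a + real b - real b * real k) \<le> val p (int k)
          \<longleftrightarrow> k = 0 \<or> M \<le> int (b * k + multiplicity p k + e)" for k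
        using le_val[of k 0] \<open>e = 0\<close> by simp
      have "T = S_from (ceil_plus ((real r - real a + real b) / real b)) \<union>
         {n \<in> multiples p. val p (int n) \<ge>
            ereal (real r - real a + real b - real b * real n)}"
        unfolding T_def using 3 by presburger
      thus ?thesis
        unfolding T'_def using \<open>E = 1\<close>
        by (simp only: set_eq_iff Un_iff mem_Collect_eq S_from_M multiples le_val') auto
    qed
  qed
  have odd: "2 * k + 1 \<in> S \<longleftrightarrow> c \<le> k" for k
    unfolding S_def lucas_int_set_prime_power[OF p] c_le
    by (rule power_dvd_lucas_U_odd[OF p _ _ ndvd ab]) fact+
  have even: "2 * k \<in> S \<longleftrightarrow> k \<in> T'" for k
  proof (cases "k = 0")
    case False
    have "2 * k \<in> S \<longleftrightarrow> r + b \<le> a + b * k \<or>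
        p dvd k \<and> (E = 0 \<or> r + b \<le> a + b * k + multiplicity p k + multiplicity (int p) E)"
      unfolding S_def lucas_int_set_prime_power[OF p] E_def
      by (rule power_dvd_lucas_U_even[OF p _ _ ndvd ab False]) fact+
    also have "\<dots> \<longleftrightarrow> k \<in> T'"
      using False unfolding T'_def M_def e_def by (auto simp del: of_nat_mult)
    finally show ?thesis .
  qed (auto simp: S_def lucas_int_set_prime_power[OF p] T'_def)
  \<comment> \<open>Here \<open>r \<le> b * (k - 1)\<close>, so \<open>b * k \<ge> r + b\<close>,
    which is at least \<open>M = r - a + b\<close>.\<close>
  have large: "k \<in> T'" if "k > c" for k
  proof -
    from that have "c \<le> k - 1" "k = Suc (k - 1)" by auto
    hence "r + b \<le> b * k"
      unfolding c_le by (metis add.commute add_le_cancel_left mult_Suc_right)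
    thus ?thesis
      unfolding T'_def M_def by (auto simp del: of_nat_mult)
  qed
  have "c \<ge> 1"
    using c_le[of 0] r by (cases c) auto
  note parity = T'_semigroup large even odd this
  show ?thesis
    using T'_semigroup parity_set_eq[OF parity] numerical_semigroup_parity_set[OF parity]
      frobenius_number_parity_set[OF parity] Gcd_small_elements_parity_set[OF parity]
    unfolding T c_int by auto
qed

end
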